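(* For all integers $m\geq 1$ and $n\geq 0$, \[ \overline{M2}(m-1,n)\geq \overline{M2}(m,n). \]
   Context: Notation: $(a;q)_\infty=\prod_{j\geq 0}(1-aq^j)$. An overpartition of $n$ is a partition of $n$ in which the first occurrence of each part size may be overlined. The crank of an ordinary partition is its largest part if it has no parts equal to $1$, and otherwise the number of parts larger than the number of ones minus the number of ones. The second residual crank of an overpartition is the crank of the ordinary partition obtained by taking all even non-overlined parts and dividing each by two. $\overline{M2}(m,n)$ is the number of overpartitions of $n$ with second residual crank $m$, with the modification that an overpartition for which this halved partition is the single part $1$ contributes $-1$ to $\overline{M2}(0,n)$ and $+1$ to each of $\overline{M2}(-1,n)$ and $\overline{M2}(1,n)$. Equivalently, \[ \sum_{m=-\infty}^{\infty}\sum_{n\geq 0}\overline{M2}(m,n)z^mq^n=\frac{(-q;q)_\infty(q;q)_\infty}{(q;q^2)_\infty(zq;q)_\infty(q/z;q)_\infty}. \]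
   Formalization: M2-bar is taken by its combinatorial definition; the product displayed as equivalent is a misprint (it gives 1 < 2 at n=2, m=1): its crank factor should be (q^2;q^2)/((zq^2;q^2)(q^2/z;q^2)). *)

theory Defs
  imports Main "HOL-Library.Multiset"
begin

definition partitions :: "nat \<Rightarrow> nat multiset set" where
  "partitions n = {p. 0 \<notin># p \<and> sum_mset p = n}"

text \<open>An overpartition is a pair of a partition and the set of those part sizes whose first
  occurrence is overlined.\<close>

definition overpartitions :: "nat \<Rightarrow> (nat multiset \<times> nat set) set" where
  "overpartitions n = {(p, S). p \<in> partitions n \<and> S \<subseteq> set_mset p}"

fun nonoverlined :: "nat multiset \<times> nat set \<Rightarrow> nat multiset" where
  "nonoverlined (p, S) = p - mset_set S"

text \<open>The largest part of the empty partition is taken to be 0, so that its crank is 0.\<close>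

definition crank :: "nat multiset \<Rightarrow> int" where
  "crank p =
    (if 1 \<notin># p then (if p = {#} then 0 else int (Max (set_mset p)))
     else int (size {# k \<in># p. k > count p 1 #}) - int (count p 1))"

definition halved_evens :: "nat multiset \<times> nat set \<Rightarrow> nat multiset" where
  "halved_evens \<pi> = image_mset (\<lambda>k. k div 2) {# k \<in># nonoverlined \<pi>. even k #}"

definition second_residual_crank :: "nat multiset \<times> nat set \<Rightarrow> int" where
  "second_residual_crank \<pi> = crank (halved_evens \<pi>)"

text \<open>The contribution of an overpartition to the count for the value \<open>m\<close>. The first branch is the
  usual modification of the crank at the partition with the single part 1; it replaces the
  contribution of that partition through its actual crank, which is \<open>- 1\<close>.\<close>

definition M2_contribution :: "int \<Rightarrow> nat multiset \<times> nat set \<Rightarrow> int" where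
  "M2_contribution m \<pi> =
    (if halved_evens \<pi> = {#1#}
     then (if m = 0 then - 1 else if m = - 1 \<or> m = 1 then 1 else 0)
     else (if second_residual_crank \<pi> = m then 1 else 0))"

definition M2_bar :: "int \<Rightarrow> nat \<Rightarrow> int" where
  "M2_bar m n = (\<Sum>\<pi>\<in>overpartitions n. M2_contribution m \<pi>)"

lemma size_le_sum_mset: "0 \<notin># p \<Longrightarrow> size p \<le> sum_mset (p :: nat multiset)"
  by (induction p) auto

lemma finite_partitions: "finite (partitions n)"
proof (rule finite_subset)
  show "partitions n \<subseteq> mset ` {xs. set xs \<subseteq> {..n} \<and> length xs \<le> n}"
  proof
    fix p assume l: "p \<in> partitions n"
    obtain xs where xs: "mset xs = p" using ex_mset by blast
    have "length xs \<le> n"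
      using l size_le_sum_mset[of p] xs by (auto simp: partitions_def)
    moreover have "x \<le> n" if "x \<in># p" for x
      using l that by (auto simp: partitions_def dest!: multi_member_split)
    ultimately show "p \<in> mset ` {xs. set xs \<subseteq> {..n} \<and> length xs \<le> n}"
      using xs by (intro image_eqI[of _ _ xs]) auto
  qed
  show "finite (mset ` {xs. set xs \<subseteq> {..n} \<and> length xs \<le> n})"
    by (intro finite_imageI finite_lists_length_le) simp
qed

lemma finite_overpartitions: "finite (overpartitions n)"
proof -
  have "overpartitions n = Sigma (partitions n) (\<lambda>p. Pow (set_mset p))"
    by (auto simp: overpartitions_def)
  then show ?thesis by (simp add: finite_partitions)
qed

end

theory Submission
  imports Defs "HOL-Computational_Algebra.Formal_Power_Series"
begin

text \<open>
  Splitting an overpartition into its overlined parts, its odd and its even non-overlined parts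
  gives \<open>\<Sum> M2_bar m n q ^ n = Y(q)\<^sup>2 C\<^sub>m(q\<^sup>2)\<close>, where \<open>Y = 1 / ((1 - q) (1 - q ^ 3) \<dots>)\<close> also counts partitions
  into distinct parts (Euler), and where sorting by the number \<open>j\<close> of ones gives, for \<open>m \<ge> 0\<close>,
  \<open>C\<^sub>m = (1 - q) \<Sum>\<^sub>j q ^ (j + (j + 1) (m + j)) / ((q)\<^sub>j (q)\<^sub>m\<^sub>+\<^sub>j)\<close>.

  Write \<open>T\<^sub>j = q ^ (j\<^sup>2 + j k) / ((q)\<^sub>j (q)\<^sub>k\<^sub>+\<^sub>j)\<close>, \<open>x = q ^ j\<close>, \<open>y = q ^ k\<close>. Repeated telescoping turns
  \<open>q (C\<^sub>k - C\<^sub>k\<^sub>+\<^sub>1)\<close> into \<open>(1 - q)\<^sup>2 y \<Sum>\<^sub>j T\<^sub>j ((q - y) x ^ 3 + y (1 - q ^ 3) x ^ 4)\<close>, and for \<open>k = 0\<close> further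
  into \<open>(1 - q) ^ 3 \<Sum>\<^sub>j T\<^sub>j x ^ 4 (q + q\<^sup>2 - (1 + q ^ 4) x + (1 - q ^ 5) x\<^sup>2)\<close>. After replacing \<open>q\<close> by \<open>q\<^sup>2\<close>,
  the factors \<open>(1 - q\<^sup>2)\<^sup>2\<close> and \<open>1 - q ^ 6\<close> are absorbed by \<open>Y\<^sup>2\<close>, and every other factor with a
  negative coefficient cancels against \<open>T\<^sub>j\<close>. The one exception is the term \<open>j = 0\<close>, \<open>k = 0\<close>, where
  \<open>1 - q ^ 4\<close> remains and \<open>(1 + q) (1 - q ^ 4) = (1 - q ^ 5) + q (1 - q ^ 3)\<close> helps.
\<close>

unbundle fps_syntax

abbreviation (input) q :: "int fps" where "q \<equiv> fps_X"

subsection \<open>Generating functions of weighted sets\<close>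

text \<open>An infinite fibre would give \<open>gf\<close> the coefficient 0, since
  \<open>sum\<close> over an infinite set is 0; additivity and multiplicativity of \<open>gf\<close>
  therefore carry this condition.\<close>

definition fin_fibres :: "'a set \<Rightarrow> ('a \<Rightarrow> nat) \<Rightarrow> bool" where
  "fin_fibres A w \<longleftrightarrow> (\<forall>n. finite {a \<in> A. w a = n})"

definition gf :: "'a set \<Rightarrow> ('a \<Rightarrow> nat) \<Rightarrow> ('a \<Rightarrow> int) \<Rightarrow> int fps" where
  "gf A w v = Abs_fps (\<lambda>n. \<Sum>a \<in> {a \<in> A. w a = n}. v a)"

lemma gf_nth: "gf A w v $ n = (\<Sum>a \<in> {a \<in> A. w a = n}. v a)"
  by (simp add: gf_def)

lemma fin_fibres_subset: "fin_fibres B w \<Longrightarrow> A \<subseteq> B \<Longrightarrow> fin_fibres A w"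
  unfolding fin_fibres_def by (auto intro: finite_subset[rotated])

lemma gf_cong:
  "A = B \<Longrightarrow> (\<And>a. a \<in> B \<Longrightarrow> w a = w' a) \<Longrightarrow> (\<And>a. a \<in> B \<Longrightarrow> v a = v' a) \<Longrightarrow> gf A w v = gf B w' v'"
  by (auto simp: gf_nth fps_eq_iff intro!: sum.cong)

lemma gf_bij:
  assumes "bij_betw f A B"
    and "\<And>a. a \<in> A \<Longrightarrow> w' (f a) = w a" and "\<And>a. a \<in> A \<Longrightarrow> v' (f a) = v a"
  shows "gf B w' v' = gf A w v"
proof (rule fps_ext)
  fix n
  have "inj_on f {a \<in> A. w a = n}"
    using assms(1) by (auto simp: bij_betw_def inj_on_def)
  moreover have "f ` {a \<in> A. w a = n} = {b \<in> B. w' b = n}"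
    using assms(1,2) by (auto simp: bij_betw_def)
  ultimately have "bij_betw f {a \<in> A. w a = n} {b \<in> B. w' b = n}"
    by (simp add: bij_betw_def)
  from sum.reindex_bij_betw[OF this, of v'] show "gf B w' v' $ n = gf A w v $ n"
    using assms(3) by (simp add: gf_nth)
qed

lemma fin_fibres_Times:
  assumes "fin_fibres A w" "fin_fibres B w'"
  shows "fin_fibres (A \<times> B) (\<lambda>(a, b). w a + w' b)"
  unfolding fin_fibres_def
proof
  fix n
  have "{x \<in> A \<times> B. (\<lambda>(a, b). w a + w' b) x = n} \<subseteq>
    (\<Union>i\<le>n. {a \<in> A. w a = i} \<times> {b \<in> B. w' b = n - i})" by auto
  moreover have "finite \<dots>" using assms by (auto simp: fin_fibres_def)
  ultimately show "finite {x \<in> A \<times> B. (\<lambda>(a, b). w a + w' b) x = n}"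
    by (rule finite_subset)
qed

lemma gf_Times:
  assumes "fin_fibres A w" "fin_fibres B w'"
  shows "gf (A \<times> B) (\<lambda>(a, b). w a + w' b) (\<lambda>(a, b). v a * v' b) = gf A w v * gf B w' v'"
proof (rule fps_ext)
  fix n
  let ?F = "\<lambda>i. {a \<in> A. w a = i} \<times> {b \<in> B. w' b = n - i}"
  have "{x \<in> A \<times> B. (\<lambda>(a, b). w a + w' b) x = n} = (\<Union>i\<in>{0..n}. ?F i)" by auto
  then have "gf (A \<times> B) (\<lambda>(a, b). w a + w' b) (\<lambda>(a, b). v a * v' b) $ n
    = (\<Sum>x \<in> (\<Union>i\<in>{0..n}. ?F i). (\<lambda>(a, b). v a * v' b) x)"
    by (simp add: gf_nth)
  also have "\<dots> = (\<Sum>i=0..n. \<Sum>x\<in>?F i. (\<lambda>(a, b). v a * v' b) x)"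
    by (rule sum.UNION_disjoint) (use assms in \<open>auto simp: fin_fibres_def\<close>)
  also have "\<dots> = (gf A w v * gf B w' v') $ n"
    by (simp add: fps_mult_nth gf_nth sum_product sum.cartesian_product)
  finally show "gf (A \<times> B) (\<lambda>(a, b). w a + w' b) (\<lambda>(a, b). v a * v' b) $ n
    = (gf A w v * gf B w' v') $ n" .
qed

lemma gf_Un:
  assumes "fin_fibres A w" "fin_fibres B w" "A \<inter> B = {}"
  shows "gf (A \<union> B) w v = gf A w v + gf B w v"
proof (rule fps_ext)
  fix n
  have "{a \<in> A \<union> B. w a = n} = {a \<in> A. w a = n} \<union> {a \<in> B. w a = n}" by auto
  then show "gf (A \<union> B) w v $ n = (gf A w v + gf B w v) $ n"
    using assms by (auto simp: gf_nth fin_fibres_def intro!: sum.union_disjoint)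
qed

lemma gf_shift: "gf A (\<lambda>a. w a + c) v = q ^ c * gf A w v"
proof (rule fps_ext)
  fix n
  have "{a \<in> A. w a + c = n} = (if n < c then {} else {a \<in> A. w a = n - c})" by auto
  then show "gf A (\<lambda>a. w a + c) v $ n = (q ^ c * gf A w v) $ n"
    by (simp add: gf_nth fps_X_power_mult_nth)
qed

lemma gf_empty: "gf {} w v = 0"
  by (simp add: fps_eq_iff gf_nth)

lemma gf_singleton: "gf {a} w (\<lambda>_. 1) = q ^ w a"
proof (rule fps_ext)
  fix n
  have "{x \<in> {a}. w x = n} = (if n = w a then {a} else {})" by auto
  then show "gf {a} w (\<lambda>_. 1) $ n = (q ^ w a) $ n" by (simp add: gf_nth)
qed

section \<open>Substitution of \<open>q ^ 2\<close> for \<open>q\<close>\<close>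

definition sq :: "int fps \<Rightarrow> int fps" where "sq f = f oo fps_X ^ 2"

lemma sq_nth: "sq f $ n = (if even n then f $ (n div 2) else 0)"
proof -
  have "sq f $ n = (\<Sum>i=0..n. if n = 2 * i then f $ i else 0)"
    by (auto simp: sq_def fps_compose_nth power_mult[symmetric] intro!: sum.cong)
  also have "\<dots> = (\<Sum>i\<in>{i\<in>{0..n}. n = 2 * i}. f $ i)"
    by (rule sum.inter_filter[symmetric]) simp
  also have "{i\<in>{0..n}. n = 2 * i} = (if even n then {n div 2} else {})" by auto
  finally show ?thesis by simp
qed

lemma sq_simps:
  "sq (f * g) = sq f * sq g" "sq (f + g) = sq f + sq g" "sq (f - g) = sq f - sq g"
  "sq 1 = 1" "sq q = q ^ 2" "sq (f ^ k) = sq f ^ k"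
proof -
  show *: "sq (f * g) = sq f * sq g" for f g by (simp add: sq_def fps_compose_mult_distrib)
  show "sq (f + g) = sq f + sq g" "sq (f - g) = sq f - sq g"
    by (simp_all add: fps_eq_iff sq_nth)
  show o: "sq 1 = 1" by (simp add: sq_def)
  show "sq q = q ^ 2" by (simp add: sq_def)
  show "sq (f ^ k) = sq f ^ k" by (induction k) (simp_all add: * o)
qed

lemma sq_gf: "gf A (\<lambda>a. 2 * w a) v = sq (gf A w v)"
proof (rule fps_ext)
  fix n
  have "{a \<in> A. 2 * w a = n} = (if even n then {a \<in> A. w a = n div 2} else {})" by auto
  then show "gf A (\<lambda>a. 2 * w a) v $ n = sq (gf A w v) $ n" by (simp add: gf_nth sq_nth)
qed

section \<open>Coefficientwise nonnegativity and approximation modulo powers of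
  \<open>q\<close>\<close>

definition nonneg :: "int fps \<Rightarrow> bool" where "nonneg f \<longleftrightarrow> (\<forall>n. 0 \<le> f $ n)"

lemma nonneg_intros:
  "nonneg 0" "nonneg 1" "nonneg (q ^ k)" "nonneg q"
  "nonneg f \<Longrightarrow> nonneg g \<Longrightarrow> nonneg (f + g)"
  "nonneg f \<Longrightarrow> nonneg g \<Longrightarrow> nonneg (f * g)"
  "nonneg f \<Longrightarrow> nonneg (sq f)"
  by (auto simp: nonneg_def fps_mult_nth fps_X_nth sq_nth intro!: sum_nonneg)

lemma nonneg_sum: "(\<And>i. i \<in> I \<Longrightarrow> nonneg (f i)) \<Longrightarrow> nonneg (sum f I)"
  by (auto simp: nonneg_def fps_sum_nth intro!: sum_nonneg)

lemma nonneg_gf: "nonneg (gf A w (\<lambda>_. 1))"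
  by (simp add: nonneg_def gf_nth)

lemma X_power_dvd_iff: "q ^ J dvd f \<longleftrightarrow> (\<forall>i<J. f $ i = 0)"
proof
  assume "\<forall>i<J. f $ i = 0"
  then have "f = q ^ J * fps_shift J f"
    by (auto simp: fps_eq_iff fps_X_power_mult_nth)
  then show "q ^ J dvd f" by (rule dvdI)
qed (auto simp: fps_X_power_mult_nth elim!: dvdE)

text \<open>Coefficient \<open>n\<close> is already determined modulo \<open>q ^ Suc n\<close>.
  Truncated sums can thus replace infinite series, and the approximant may change with
  \<open>J\<close>.\<close>

lemma nonneg_limit:
  assumes "\<And>J. \<exists>g. nonneg g \<and> q ^ J dvd (f - g)"
  shows "nonneg f"
  unfolding nonneg_def
proof
  fix n
  obtain g where "nonneg g" "q ^ Suc n dvd (f - g)" using assms by blast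
  then have "(f - g) $ n = 0" "0 \<le> g $ n"
    unfolding X_power_dvd_iff nonneg_def by auto
  then show "0 \<le> f $ n" by simp
qed

subsection \<open>Partitions with restricted parts\<close>

text \<open>Excluding 0 keeps the fibres of \<open>sum_mset\<close> finite, so \<open>UNIV\<close>
  can stand for unrestricted partitions.\<close>

definition parts_in :: "nat set \<Rightarrow> nat multiset set" where
  "parts_in P = {p. set_mset p \<subseteq> P - {0}}"

definition pgf :: "nat set \<Rightarrow> int fps" where
  "pgf P = gf (parts_in P) sum_mset (\<lambda>_. 1)"

lemma fin_fibres_parts_in: "fin_fibres (parts_in P) sum_mset"
  unfolding fin_fibres_def
proof
  fix n
  have "{a \<in> parts_in P. \<Sum>\<^sub># a = n} \<subseteq> partitions n"
    by (auto simp: parts_in_def partitions_def)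
  then show "finite {a \<in> parts_in P. \<Sum>\<^sub># a = n}"
    using finite_partitions finite_subset by blast
qed

lemma nonneg_pgf: "nonneg (pgf P)"
  by (simp add: pgf_def nonneg_gf)

text \<open>Adding a copy of \<open>a\<close> maps all these partitions bijectively onto those
  containing \<open>a\<close>. This encodes the factor \<open>1 / (1 - q ^ a)\<close> without
  inverting a series.\<close>

lemma pgf_insert:
  assumes "a \<notin> P" "a > 0"
  shows "(1 - q ^ a) * pgf (insert a P) = pgf P"
proof -
  let ?B = "{p \<in> parts_in (insert a P). a \<in># p}"
  have "bij_betw (add_mset a) (parts_in (insert a P)) ?B"
    by (rule bij_betw_byWitness[where f' = "\<lambda>p. p - {#a#}"])
       (use assms in \<open>auto simp: parts_in_def dest: in_diffD\<close>)
  then have "gf ?B sum_mset (\<lambda>_. 1) = gf (parts_in (insert a P)) (\<lambda>p. sum_mset p + a) (\<lambda>_. 1)"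
    by (rule gf_bij) auto
  then have B: "gf ?B sum_mset (\<lambda>_. 1) = q ^ a * pgf (insert a P)"
    by (simp add: gf_shift pgf_def)
  have "parts_in (insert a P) = parts_in P \<union> ?B"
    using assms by (auto simp: parts_in_def)
  moreover have "parts_in P \<inter> ?B = {}" using assms by (auto simp: parts_in_def)
  ultimately have "pgf (insert a P) = pgf P + gf ?B sum_mset (\<lambda>_. 1)"
    unfolding pgf_def
    by (metis (no_types, lifting) fin_fibres_parts_in fin_fibres_subset gf_Un le_sup_iff order_refl)
  then show ?thesis by (simp add: B algebra_simps)
qed

lemma pgf_remove: "a \<in> P \<Longrightarrow> a > 0 \<Longrightarrow> (1 - q ^ a) * pgf P = pgf (P - {a})"
  using pgf_insert[of a "P - {a}"] by (simp add: insert_absorb)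

lemma pgf_empty: "pgf {} = 1"
proof -
  have "parts_in {} = {{#}}" by (auto simp: parts_in_def)
  then show ?thesis by (simp add: pgf_def gf_singleton)
qed

text \<open>\<open>inv_qfac i\<close> is \<open>1 / ((1 - q) \<dots> (1 - q ^ i))\<close>.\<close>

definition inv_qfac :: "nat \<Rightarrow> int fps" where "inv_qfac i = pgf {1..i}"

lemma inv_qfac_0: "inv_qfac 0 = 1"
  by (simp add: inv_qfac_def pgf_empty)

lemma inv_qfac_Suc: "(1 - q ^ Suc i) * inv_qfac (Suc i) = inv_qfac i"
proof -
  have "{1..Suc i} - {Suc i} = {1..i}" by auto
  then show ?thesis using pgf_remove[of "Suc i" "{1..Suc i}"] by (simp add: inv_qfac_def)
qed

lemma one_minus_X_power_neq_0: "a > 0 \<Longrightarrow> 1 - q ^ a \<noteq> 0"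
proof
  assume "a > 0" "1 - q ^ a = 0"
  then have "(1 - q ^ a) $ 0 = 0" by simp
  then show False using \<open>a > 0\<close> by simp
qed

definition sized :: "nat \<Rightarrow> nat \<Rightarrow> nat multiset set" where
  "sized s a = {p. size p = s \<and> set_mset p \<subseteq> {a..}}"

lemma fin_fibres_sized: "a > 0 \<Longrightarrow> fin_fibres (sized s a) sum_mset"
  by (rule fin_fibres_subset[OF fin_fibres_parts_in[of UNIV]]) (auto simp: sized_def parts_in_def)

text \<open>A multiset of \<open>s\<close> parts \<open>\<ge> a\<close> either contains \<open>a\<close>, which can be removed, or it has only parts
  \<open>\<ge> a + 1\<close>, which can all be lowered by 1.\<close>

lemma gf_sized:
  assumes "a > 0"
  shows "gf (sized s a) sum_mset (\<lambda>_. 1) = q ^ (a * s) * inv_qfac s"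
proof (induction s)
  case 0
  have "sized 0 a = {{#}}" by (auto simp: sized_def)
  then show ?case by (simp add: gf_singleton inv_qfac_0)
next
  case (Suc s)
  let ?B = "{p \<in> sized (Suc s) a. a \<in># p}"
  let ?h = "gf (sized (Suc s) a) sum_mset (\<lambda>_. 1)"
  have "bij_betw (add_mset a) (sized s a) ?B"
    by (rule bij_betw_byWitness[where f' = "\<lambda>p. p - {#a#}"])
       (auto simp: sized_def size_Diff_singleton dest: in_diffD)
  then have "gf ?B sum_mset (\<lambda>_. 1) = gf (sized s a) (\<lambda>p. sum_mset p + a) (\<lambda>_. 1)"
    by (rule gf_bij) auto
  then have B: "gf ?B sum_mset (\<lambda>_. 1) = q ^ a * (q ^ (a * s) * inv_qfac s)"
    by (simp add: gf_shift Suc)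
  have "bij_betw (image_mset Suc) (sized (Suc s) a) (sized (Suc s) (Suc a))"
  proof (rule bij_betw_byWitness[where f' = "image_mset (\<lambda>k. k - 1)"])
    show "\<forall>p\<in>sized (Suc s) (Suc a). image_mset Suc (image_mset (\<lambda>k. k - 1) p) = p"
    proof
      fix p assume "p \<in> sized (Suc s) (Suc a)"
      then have "\<And>k. k \<in># p \<Longrightarrow> Suc (k - 1) = k" by (auto simp: sized_def)
      then show "image_mset Suc (image_mset (\<lambda>k. k - 1) p) = p"
        by (simp add: image_mset.compositionality comp_def cong: image_mset_cong)
    qed
  qed (fastforce simp: sized_def image_mset.compositionality comp_def)+
  moreover have "sum_mset (image_mset Suc p) = sum_mset p + size p" for p
    by (induction p) auto
  ultimately have "gf (sized (Suc s) (Suc a)) sum_mset (\<lambda>_. 1)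
      = gf (sized (Suc s) a) (\<lambda>p. sum_mset p + Suc s) (\<lambda>_. 1)"
    by (intro gf_bij) (auto simp: sized_def)
  then have C: "gf (sized (Suc s) (Suc a)) sum_mset (\<lambda>_. 1) = q ^ Suc s * ?h"
    by (simp only: gf_shift)
  have "sized (Suc s) a = sized (Suc s) (Suc a) \<union> ?B"
    by (force simp: sized_def Suc_le_eq order_le_less)
  moreover have "sized (Suc s) (Suc a) \<inter> ?B = {}" by (auto simp: sized_def)
  moreover have "fin_fibres ?B sum_mset" "fin_fibres (sized (Suc s) (Suc a)) sum_mset"
    using fin_fibres_sized[OF assms, of "Suc s"] fin_fibres_sized[of "Suc a" "Suc s"]
    by (auto intro: fin_fibres_subset)
  ultimately have "?h = gf (sized (Suc s) (Suc a)) sum_mset (\<lambda>_. 1) + gf ?B sum_mset (\<lambda>_. 1)"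
    using gf_Un by metis
  then have "(1 - q ^ Suc s) * ?h = q ^ a * (q ^ (a * s) * inv_qfac s)"
    unfolding B C by (simp add: algebra_simps)
  also have "\<dots> = (1 - q ^ Suc s) * (q ^ (a * Suc s) * inv_qfac (Suc s))"
    by (simp add: inv_qfac_Suc[of s, symmetric] power_add mult_ac)
  finally show ?case using one_minus_X_power_neq_0[of "Suc s"] by simp
qed

subsection \<open>Telescoping the difference of two crank series\<close>

text \<open>The \<open>j\<close>-th summand comes from the partitions with exactly \<open>j\<close> ones; the sum is truncated at
  \<open>J\<close> so that all identities are finite, with remainders divisible by \<open>q ^ J\<close>.\<close>

definition crank_sum :: "nat \<Rightarrow> nat \<Rightarrow> int fps" where
  "crank_sum m J =
    (1 - q) * (\<Sum>j<J. q ^ (j + (j + 1) * (m + j)) * inv_qfac j * inv_qfac (m + j))"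

text \<open>This is \<open>T\<^sub>j\<close> above: it counts partitions by a Durfee rectangle with
  sides \<open>j\<close> and \<open>j + k\<close>.\<close>

definition durfee :: "nat \<Rightarrow> nat \<Rightarrow> int fps" where
  "durfee k j = q ^ (j * j + j * k) * inv_qfac j * inv_qfac (k + j)"

definition diff_term :: "nat \<Rightarrow> nat \<Rightarrow> int fps" where
  "diff_term k j = q ^ k * durfee k j *
    ((q - q ^ k) * q ^ (3 * j) + q ^ k * (1 - q ^ 3) * q ^ (4 * j))"

text \<open>One of the three factors \<open>1 - q\<close> of the formula for \<open>k = 0\<close>
  sits inside, so that this sum takes the same outer factor \<open>(1 - q) ^ 2\<close> as
  \<open>diff_term\<close>.\<close>

definition diff_term0 :: "nat \<Rightarrow> int fps" where
  "diff_term0 j = (1 - q) * durfee 0 j * q ^ (4 * j) *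
    (q + q ^ 2 - (1 + q ^ 4) * q ^ j + (1 - q ^ 5) * q ^ (2 * j))"

text \<open>Here \<open>x = q ^ j\<close>, \<open>y = q ^ k\<close>, \<open>b = q ^ (j\<^sup>2 + j k)\<close>, and \<open>P\<close>, \<open>R\<close> are the inverse \<open>q\<close>-factorials
  of \<open>j + 1\<close> and \<open>k + j + 1\<close>; the last two summands are the values of one function at \<open>j\<close> and \<open>j + 1\<close>.
  They arise from the relation that telescopes the Durfee terms times
  \<open>(1 - x) (1 - y x) r x - q y x\<^sup>2 r (q x)\<close> with \<open>r x = x\<^sup>2\<close>.\<close>

lemma telescope_identity:
  fixes q x y b P R :: "'a :: idom"
  shows "q * (b * x^2 * y * ((1-q*x)*P) * ((1-q*x*y)*R) - b * x^2 * y * (q * x) * ((1-q*x)*P) * R)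
    = (1-q) * y * b * ((1-q*x)*P) * ((1-q*x*y)*R) * ((q-y)*x^3 + y*(1-q^3)*x^4)
      + b * ((1-q*x)*P) * ((1-q*x*y)*R) * (y*x^2*(1-x) * (1 - (1-q)*(1-y*x)))
      - (b*x^2*q*y) * P * R * (y*(q*x)^2*(1-q*x)*(1 - (1-q)*(1-y*(q*x))))"
  by algebra

text \<open>For \<open>k = 0\<close> the terms above are not positive; this uses the same relation with \<open>y = 1\<close> and
  \<open>r x = x\<^sup>3 + x\<^sup>4\<close>.\<close>

lemma telescope_identity0:
  fixes q x b P R :: "'a :: idom"
  shows "b * ((1-q*x)*P) * ((1-q*x)*R) * ((q-1)*x^3 + (1-q^3)*x^4)
    = (1-q) * (b * ((1-q*x)*P) * ((1-q*x)*R) * x^4 * (q + q^2 - (1+q^4)*x + (1-q^5)*x^2))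
      - (1-q) * (b * ((1-q*x)*P) * ((1-q*x)*R) * ((1-x)^2*x^3*(1+x))
      - (b*x^2*q) * P * R * ((1-q*x)^2*(q*x)^3*(1+q*x)))"
  by algebra

text \<open>Expressing the inverse factorials at \<open>j\<close> by those at \<open>j + 1\<close>
  turns the telescoping into polynomial identities.\<close>

lemma inv_qfac_split: "inv_qfac j = (1 - q * q ^ j) * inv_qfac (Suc j)"
  using inv_qfac_Suc[of j] by simp

lemma inv_qfac_split2: "inv_qfac (k + j) = (1 - q * q ^ j * q ^ k) * inv_qfac (Suc (k + j))"
  using inv_qfac_Suc[of "k + j"] by (simp add: power_add mult_ac)

text \<open>Telescoping leaves only the boundary value at \<open>J\<close>, because the one at 0 has
  the factor \<open>1 - q ^ 0\<close>. Its factor \<open>q ^ (2 * J)\<close> makes it vanish modulo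
  \<open>q ^ J\<close>.\<close>

lemma crank_sum_diff:
  "q * (crank_sum k J - crank_sum (Suc k) J) =
    (1 - q) * ((1 - q) * (\<Sum>j<J. diff_term k j)
      - durfee k J * (q ^ k * q ^ (2 * J) * (1 - q ^ J) * (1 - (1 - q) * (1 - q ^ k * q ^ J))))"
proof -
  define G where "G j = durfee k j *
    (q ^ k * q ^ (2 * j) * (1 - q ^ j) * (1 - (1 - q) * (1 - q ^ k * q ^ j)))" for j
  define t where "t j = q * (q ^ (j + (j + 1) * (k + j)) * inv_qfac j * inv_qfac (k + j)
      - q ^ (j + (j + 1) * (Suc k + j)) * inv_qfac j * inv_qfac (Suc k + j))" for j
  have step: "t j = (1 - q) * diff_term k j + G j - G (Suc j)" for j
  proof -
    have e: "q ^ (j + (j + 1) * (k + j)) = q ^ (j * j + j * k) * (q ^ j) ^ 2 * q ^ k"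
      "q ^ (j + (j + 1) * (Suc k + j)) = q ^ (j * j + j * k) * (q ^ j) ^ 2 * q ^ k * (q * q ^ j)"
      "q ^ (Suc j * Suc j + Suc j * k) = q ^ (j * j + j * k) * (q ^ j) ^ 2 * q * q ^ k"
      "q ^ (4 * j) = (q ^ j) ^ 4" "q ^ (3 * j) = (q ^ j) ^ 3" "q ^ (2 * j) = (q ^ j) ^ 2"
      "q ^ (2 * Suc j) = (q * q ^ j) ^ 2" "q ^ Suc j = q * q ^ j"
      by (simp_all add: power_add[symmetric] power_mult[symmetric] algebra_simps
           power_mult_distrib power2_eq_square flip: power_Suc)
    have "Suc k + j = Suc (k + j)" "k + Suc j = Suc (k + j)" by simp_all
    then show ?thesis
      unfolding t_def G_def diff_term_def durfee_def e
      using telescope_identity[of q "q ^ (j * j + j * k)" "q ^ j" "q ^ k"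
          "inv_qfac (Suc j)" "inv_qfac (Suc (k + j))"]
      unfolding inv_qfac_split[of j, symmetric] inv_qfac_split2[of k j, symmetric]
      by (simp only: mult_ac)
  qed
  have "(\<Sum>j<J. t j) = (\<Sum>j<J. (1 - q) * diff_term k j - (G (Suc j) - G j))"
    by (rule sum.cong) (simp_all add: step)
  also have "\<dots> = (1 - q) * (\<Sum>j<J. diff_term k j) - (\<Sum>j<J. G (Suc j) - G j)"
    by (simp only: sum_subtractf sum_distrib_left)
  also have "(\<Sum>j<J. G (Suc j) - G j) = G J - G 0"
    by (rule sum_lessThan_telescope)
  also have "G 0 = 0" by (simp add: G_def)
  finally have "(\<Sum>j<J. t j) = (1 - q) * (\<Sum>j<J. diff_term k j) - G J" by simp
  moreover have "q * (crank_sum k J - crank_sum (Suc k) J) = (1 - q) * (\<Sum>j<J. t j)"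
    by (simp add: crank_sum_def t_def sum_subtractf sum_distrib_left right_diff_distrib mult_ac)
  ultimately show ?thesis by (simp add: G_def)
qed

text \<open>The second telescoping: the boundary value again vanishes at 0 and is divisible by
  \<open>q ^ (3 * J)\<close> at \<open>J\<close>.\<close>

lemma diff_term0_sum:
  "(\<Sum>j<J. diff_term 0 j) = (\<Sum>j<J. diff_term0 j)
    + (1 - q) * (durfee 0 J * ((1 - q ^ J) ^ 2 * q ^ (3 * J) * (1 + q ^ J)))"
proof -
  define G where "G j = durfee 0 j * ((1 - q ^ j) ^ 2 * q ^ (3 * j) * (1 + q ^ j))" for j
  have step: "diff_term 0 j = diff_term0 j + (1 - q) * (G (Suc j) - G j)" for j
  proof -
    have e: "q ^ (Suc j * Suc j + Suc j * 0) = q ^ (j * j + j * 0) * (q ^ j) ^ 2 * q"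
      "q ^ (4 * j) = (q ^ j) ^ 4" "q ^ (3 * j) = (q ^ j) ^ 3" "q ^ (2 * j) = (q ^ j) ^ 2"
      "q ^ (3 * Suc j) = (q * q ^ j) ^ 3" "q ^ Suc j = q * q ^ j"
      by (simp_all add: power_add[symmetric] power_mult[symmetric] algebra_simps
           power_mult_distrib power2_eq_square flip: power_Suc)
    show ?thesis
      using telescope_identity0[of "q ^ (j * j + j * 0)" q "q ^ j"
          "inv_qfac (Suc j)" "inv_qfac (Suc j)"]
      unfolding inv_qfac_split[of j, symmetric]
      unfolding G_def diff_term_def diff_term0_def durfee_def e
      by (simp add: algebra_simps)
  qed
  have "(\<Sum>j<J. diff_term 0 j) = (\<Sum>j<J. diff_term0 j) + (1 - q) * (\<Sum>j<J. G (Suc j) - G j)"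
    by (simp add: step sum.distrib sum_distrib_left)
  also have "(\<Sum>j<J. G (Suc j) - G j) = G J - G 0"
    by (rule sum_lessThan_telescope)
  also have "G 0 = 0" by (simp add: G_def)
  finally show ?thesis by (simp add: G_def)
qed

section \<open>Cancelling negative factors against inverse factorials\<close>

lemma nonneg_inv_qfac: "nonneg (inv_qfac i)"
  by (simp add: inv_qfac_def nonneg_pgf)

lemma nonneg_one_minus_mult_inv_qfac:
  assumes "i > 0"
  shows "nonneg ((1 - q) * inv_qfac i)"
  using pgf_remove[of 1 "{1..i}"] assms by (simp add: inv_qfac_def nonneg_pgf)

text \<open>One factor \<open>1 - q\<close> removes the part 1, and the cofactor
  \<open>1 + q + ... + q ^ (a - 1)\<close> is nonnegative, so \<open>a\<close> may exceed
  \<open>i\<close>.\<close>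

lemma nonneg_one_minus_power_mult_inv_qfac:
  assumes "i > 0"
  shows "nonneg ((1 - q ^ a) * inv_qfac i)"
proof -
  have "(1 - q ^ a) * inv_qfac i = (\<Sum>l<a. q ^ l) * ((1 - q) * inv_qfac i)"
    by (simp add: one_diff_power_eq mult_ac)
  moreover have "nonneg \<dots>"
    by (intro nonneg_intros(6) nonneg_sum nonneg_one_minus_mult_inv_qfac assms nonneg_intros(3))
  ultimately show ?thesis by (simp only:)
qed

subsection \<open>Positivity\<close>

definition odd_gf :: "nat \<Rightarrow> int fps" where "odd_gf a = pgf {n. odd n \<and> n \<ge> a}"

lemma odd_gf_step: "odd a \<Longrightarrow> (1 - q ^ a) * odd_gf a = odd_gf (a + 2)"
proof -
  assume a: "odd a"
  then have "{n. odd n \<and> n \<ge> a} - {a} = {n. odd n \<and> n \<ge> a + 2}"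
    by auto presburger
  then show ?thesis using a pgf_remove[of a "{n. odd n \<and> n \<ge> a}"]
    by (simp add: odd_gf_def odd_pos)
qed

lemma nonneg_odd_gf: "nonneg (odd_gf a)"
  by (simp add: odd_gf_def nonneg_pgf)

text \<open>\<open>1 - q ^ 2\<close> and \<open>1 - q ^ 6\<close> contain \<open>1 - q\<close> and
  \<open>1 - q ^ 3\<close>, which delete the parts 1 and 3 from a copy of \<open>odd_gf\<close>. In
  the third identity, \<open>(1 + q) * (1 - q ^ 4) = (1 - q ^ 5) + q * (1 - q ^ 3)\<close> deletes
  the part 5 in one summand and 3 in the other.\<close>

lemma odd_gf_identities:
  "odd_gf 1 ^ 2 * (1 - q ^ 2) ^ 2 = (1 + q) * (1 + q) * odd_gf 3 * odd_gf 3"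
  "odd_gf 1 ^ 2 * (1 - q ^ 2) ^ 2 * (1 - q ^ 6)
     = (1 + q) * (1 + q) * (1 + q ^ 3) * odd_gf 3 * odd_gf 5"
  "odd_gf 1 ^ 2 * (1 - q ^ 2) ^ 2 * (1 - q ^ 4) * (1 - q ^ 6)
     = (1 + q) * (1 + q ^ 3) * (odd_gf 3 * odd_gf 7 + q * odd_gf 5 * odd_gf 5)"
proof -
  have a: "odd_gf 3 = (1 - q) * odd_gf 1" using odd_gf_step[of 1] by (simp add: numeral_eq_Suc)
  have b: "odd_gf 5 = (1 - q ^ 3) * odd_gf 3" using odd_gf_step[of 3] by simp
  have c: "odd_gf 7 = (1 - q ^ 5) * odd_gf 5" using odd_gf_step[of 5] by simp
  show "odd_gf 1 ^ 2 * (1 - q ^ 2) ^ 2 = (1 + q) * (1 + q) * odd_gf 3 * odd_gf 3"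
    unfolding a by algebra
  show "odd_gf 1 ^ 2 * (1 - q ^ 2) ^ 2 * (1 - q ^ 6)
     = (1 + q) * (1 + q) * (1 + q ^ 3) * odd_gf 3 * odd_gf 5"
    unfolding b a by algebra
  show "odd_gf 1 ^ 2 * (1 - q ^ 2) ^ 2 * (1 - q ^ 4) * (1 - q ^ 6)
     = (1 + q) * (1 + q ^ 3) * (odd_gf 3 * odd_gf 7 + q * odd_gf 5 * odd_gf 5)"
    unfolding c b a by algebra
qed

lemma nonneg_odd_gf_products:
  "nonneg (odd_gf 1 ^ 2 * (1 - q ^ 2) ^ 2)"
  "nonneg (odd_gf 1 ^ 2 * (1 - q ^ 2) ^ 2 * (1 - q ^ 6))"
  "nonneg (odd_gf 1 ^ 2 * (1 - q ^ 2) ^ 2 * (1 - q ^ 4) * (1 - q ^ 6))"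
  subgoal unfolding odd_gf_identities(1) by (intro nonneg_intros nonneg_odd_gf)
  subgoal unfolding odd_gf_identities(2) by (intro nonneg_intros nonneg_odd_gf)
  subgoal unfolding odd_gf_identities(3) by (intro nonneg_intros nonneg_odd_gf)
  done

text \<open>For \<open>k > 0\<close>, \<open>q - q ^ k = q * (1 - q ^ (k - 1))\<close>, and the last
  factor cancels against \<open>inv_qfac (k + j)\<close>. The factor \<open>1 - q ^ 3\<close>
  becomes \<open>1 - q ^ 6\<close> under \<open>sq\<close> and is left to
  \<open>odd_gf 1 ^ 2\<close>.\<close>

lemma nonneg_diff_term:
  assumes "k > 0"
  shows "nonneg (odd_gf 1 ^ 2 * sq ((1 - q) ^ 2 * diff_term k j))"
proof -
  obtain k' where k: "k = Suc k'" using assms by (cases k) auto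
  define A where "A = q ^ k * q ^ (j * j + j * k) * q * q ^ (3 * j) * inv_qfac j
    * ((1 - q ^ k') * inv_qfac (k + j))"
  define B where "B = q ^ k * q ^ (j * j + j * k) * q ^ k * q ^ (4 * j) * inv_qfac j
    * inv_qfac (k + j)"
  have A: "nonneg A" unfolding A_def
    by (intro nonneg_intros nonneg_inv_qfac nonneg_one_minus_power_mult_inv_qfac) (simp add: k)
  have B: "nonneg B" unfolding B_def
    by (intro nonneg_intros nonneg_inv_qfac)
  have "diff_term k j = A + (1 - q ^ 3) * B"
    by (simp add: diff_term_def durfee_def A_def B_def k algebra_simps)
  then have "odd_gf 1 ^ 2 * sq ((1 - q) ^ 2 * diff_term k j) =
    (odd_gf 1 ^ 2 * (1 - q ^ 2) ^ 2) * sq A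
     + (odd_gf 1 ^ 2 * (1 - q ^ 2) ^ 2 * (1 - q ^ 6)) * sq B"
    by (simp add: sq_simps distrib_left mult_ac flip: power_mult)
  moreover have "nonneg \<dots>"
    by (intro nonneg_intros(5-7) A B nonneg_odd_gf_products)
  ultimately show ?thesis by (simp only:)
qed

text \<open>With \<open>x = q * u\<close>, the negative term \<open>(1 + q ^ 4) * x\<close> is split
  between \<open>q\<close> and \<open>q ^ 2\<close>. Each resulting bracket takes one copy of
  \<open>p\<close>, and \<open>1 - q\<close> takes the other.\<close>

lemma factor_identity:
  fixes q :: "'a :: idom"
  shows "(1 - q) * (w * p * p) * z * (q + q^2 - (1 + q^4) * (q * u) + (1 - q^5) * v)
    = w * z * ((1 - q) * p) * (q * ((1 - u) * p) + q^2 * ((1 - q^3 * u) * p) + v * ((1 - q^5) * p))"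
  by algebra

lemma nonneg_diff_term0: "nonneg (odd_gf 1 ^ 2 * sq ((1 - q) ^ 2 * diff_term0 j))"
proof (cases "j = 0")
  case True
  \<comment> \<open>The bracket at \<open>j = 0\<close> is \<open>q * (1 + q) * (1 - q ^ 3)\<close>.
    The inverse factorials are 1 here, so \<open>odd_gf 1 ^ 2\<close> has to absorb
    everything.\<close>
  have "diff_term0 0 = q * (1 - q ^ 2) * (1 - q ^ 3)"
    unfolding diff_term0_def durfee_def by (simp add: inv_qfac_0) algebra
  then have "odd_gf 1 ^ 2 * sq ((1 - q) ^ 2 * diff_term0 0)
    = q ^ 2 * (odd_gf 1 ^ 2 * (1 - q ^ 2) ^ 2 * (1 - q ^ 4) * (1 - q ^ 6))"
    by (simp add: sq_simps mult_ac flip: power_mult)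
  moreover have "nonneg \<dots>"
    by (intro nonneg_intros(6) nonneg_intros(3) nonneg_odd_gf_products)
  ultimately show ?thesis by (simp only: True)
next
  case False
  then obtain i where j: "j = Suc i" by (cases j) auto
  define A where "A = q ^ (j * j) * q ^ (4 * j) * ((1 - q) * inv_qfac j)
    * (q * ((1 - q ^ i) * inv_qfac j) + q ^ 2 * ((1 - q ^ (i + 3)) * inv_qfac j)
       + q ^ (2 * j) * ((1 - q ^ 5) * inv_qfac j))"
  have A: "nonneg A" unfolding A_def
    by (intro nonneg_intros nonneg_one_minus_power_mult_inv_qfac
        nonneg_one_minus_mult_inv_qfac) (use j in simp_all)
  have e: "q ^ j = q * q ^ i" "q ^ (i + 3) = q ^ 3 * q ^ i" by (simp_all add: j power_add mult_ac)
  have "diff_term0 j = A"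
    unfolding diff_term0_def durfee_def A_def e
    using factor_identity[of q "q ^ (j * j)" "inv_qfac j" "q ^ (4 * j)" "q ^ i" "q ^ (2 * j)"]
    by (simp only: mult_0_right add_0 add_0_right)
  then have "odd_gf 1 ^ 2 * sq ((1 - q) ^ 2 * diff_term0 j) =
    (odd_gf 1 ^ 2 * (1 - q ^ 2) ^ 2) * sq A"
    by (simp add: sq_simps mult_ac)
  moreover have "nonneg \<dots>"
    by (intro nonneg_intros(6,7) A nonneg_odd_gf_products)
  ultimately show ?thesis by (simp only:)
qed

section \<open>Passing from truncated sums to the full series\<close>

lemma dvd_sq: "q ^ J dvd f \<Longrightarrow> q ^ J dvd sq f"
  unfolding X_power_dvd_iff by (auto simp: sq_nth)

lemma X_power_dvd_durfee: "q ^ J dvd q ^ (a * J) * durfee k J" if "a > 0"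
proof -
  have "q ^ J dvd q ^ (a * J)" using that by (intro le_imp_power_dvd) simp
  then show ?thesis by simp
qed

lemma nonneg_crank_diff:
  assumes "\<And>J. q ^ J dvd (c - crank_sum k J)" "\<And>J. q ^ J dvd (d - crank_sum (Suc k) J)"
  shows "nonneg (odd_gf 1 ^ 2 * sq (c - d))"
proof -
  \<comment> \<open>The factor \<open>q\<close> matches \<open>crank_sum_diff\<close>;
    \<open>sq\<close> turns it into \<open>q ^ 2\<close>, a shift by two that is undone at the
    end.\<close>
  have "nonneg (odd_gf 1 ^ 2 * sq (q * (c - d)))"
  proof (rule nonneg_limit)
    fix J
    define T where "T j = (if k = 0 then diff_term0 j else diff_term k j)" for j
    define E where "E = odd_gf 1 ^ 2"
    \<comment> \<open>For \<open>k = 0\<close> the switch to \<open>diff_term0\<close> costs a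
      boundary term divisible by \<open>q ^ J\<close>.\<close>
    have 1: "q ^ J dvd (1 - q) ^ 2 * (\<Sum>j<J. diff_term k j) - (1 - q) ^ 2 * (\<Sum>j<J. T j)"
    proof (cases "k = 0")
      case True
      have "(1 - q) ^ 2 * (\<Sum>j<J. diff_term k j) - (1 - q) ^ 2 * (\<Sum>j<J. T j)
        = (q ^ (3 * J) * durfee 0 J) * ((1 - q) ^ 2 * (1 - q) * ((1 - q ^ J) ^ 2 * (1 + q ^ J)))"
        using diff_term0_sum[of J] True by (simp add: T_def distrib_left mult_ac)
      then show ?thesis
        using X_power_dvd_durfee[of 3 J 0] by (metis dvd_mult2 zero_less_numeral)
    qed (simp add: T_def)
    have 2: "q ^ J dvd q * (crank_sum k J - crank_sum (Suc k) J)
       - (1 - q) ^ 2 * (\<Sum>j<J. diff_term k j)"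
    proof -
      have "q * (crank_sum k J - crank_sum (Suc k) J) - (1 - q) ^ 2 * (\<Sum>j<J. diff_term k j)
        = (q ^ (2 * J) * durfee k J) *
          (- (1 - q) * (q ^ k * (1 - q ^ J) * (1 - (1 - q) * (1 - q ^ k * q ^ J))))"
      proof -
        have "(1 - q) * ((1 - q) * S - D * (a * w * b * c)) - (1 - q) ^ 2 * S
          = (w * D) * (- (1 - q) * (a * b * c))" for a b c w S D :: "int fps"
          by algebra
        then show ?thesis unfolding crank_sum_diff .
      qed
      then show ?thesis
        using X_power_dvd_durfee[of 2 J k] by (metis dvd_mult2 zero_less_numeral)
    qed
    have 3: "q ^ J dvd q * (c - d) - q * (crank_sum k J - crank_sum (Suc k) J)"
    proof -
      have "q * (c - d) - q * (crank_sum k J - crank_sum (Suc k) J)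
        = q * (c - crank_sum k J) - q * (d - crank_sum (Suc k) J)" by (simp add: algebra_simps)
      then show ?thesis using assms[of J] by (simp add: dvd_diff)
    qed
    have "q ^ J dvd q * (c - d) - (1 - q) ^ 2 * (\<Sum>j<J. T j)"
      using dvd_add[OF 3 dvd_add[OF 2 1]] by simp
    then have "q ^ J dvd E * sq (q * (c - d) - (1 - q) ^ 2 * (\<Sum>j<J. T j))"
      by (intro dvd_mult dvd_sq)
    also have "E * sq (q * (c - d) - (1 - q) ^ 2 * (\<Sum>j<J. T j))
      = E * sq (q * (c - d)) - E * sq ((1 - q) ^ 2 * (\<Sum>j<J. T j))"
      by (simp add: sq_simps right_diff_distrib)
    finally have "q ^ J dvd E * sq (q * (c - d)) - E * sq ((1 - q) ^ 2 * (\<Sum>j<J. T j))" .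
    moreover have "nonneg (E * sq ((1 - q) ^ 2 * (\<Sum>j<J. T j)))"
    proof -
      have "sq (\<Sum>j<J. f j) = (\<Sum>j<J. sq (f j))" for f
        by (induction J) (simp_all add: sq_simps, simp add: fps_eq_iff sq_nth)
      then have "E * sq ((1 - q) ^ 2 * (\<Sum>j<J. T j)) = (\<Sum>j<J. E * sq ((1 - q) ^ 2 * T j))"
        by (simp add: sum_distrib_left)
      then show ?thesis
        using nonneg_diff_term[of k] nonneg_diff_term0
        by (auto simp: T_def E_def intro!: nonneg_sum)
    qed
    ultimately show "\<exists>g. nonneg g \<and> q ^ J dvd odd_gf 1 ^ 2 * sq (q * (c - d)) - g"
      unfolding E_def by blast
  qed
  moreover have "odd_gf 1 ^ 2 * sq (q * (c - d)) = q ^ 2 * (odd_gf 1 ^ 2 * sq (c - d))"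
    by (simp add: sq_simps mult_ac)
  ultimately have *: "nonneg (q ^ 2 * (odd_gf 1 ^ 2 * sq (c - d)))" by (simp only:)
  show ?thesis unfolding nonneg_def
  proof
    fix n
    show "0 \<le> (odd_gf 1 ^ 2 * sq (c - d)) $ n"
      using *[unfolded nonneg_def, rule_format, of "n + 2"]
      unfolding fps_X_power_mult_nth by simp
  qed
qed

subsection \<open>Euler's theorem on odd and distinct parts\<close>

text \<open>A factor with constant term 1 does not change the order of vanishing at
  \<open>q = 0\<close>.\<close>

lemma X_power_dvd_cancel:
  assumes "u $ 0 = 1" "q ^ J dvd u * f"
  shows "q ^ J dvd f"
proof (cases "f = 0")
  case False
  have "u \<noteq> 0" using assms(1) by auto
  then have sub: "subdegree (u * f) = subdegree f"
    using False assms(1) by (simp add: subdegree_eq_0)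
  have "f $ i = 0" if "i < J" for i
  proof -
    have "(u * f) $ subdegree f \<noteq> 0"
      using nth_subdegree_nonzero[of "u * f"] False \<open>u \<noteq> 0\<close> sub by simp
    then have "J \<le> subdegree f"
      using assms(2) unfolding X_power_dvd_iff by (meson not_le_imp_less)
    then show ?thesis using that by (simp add: nth_less_subdegree_zero)
  qed
  then show ?thesis by (simp add: X_power_dvd_iff)
qed simp

lemma X_power_dvd_all_imp_0:
  assumes "\<And>J. q ^ J dvd f"
  shows "f = 0"
proof (rule fps_ext)
  fix n show "f $ n = 0 $ n" using assms[of "Suc n"] unfolding X_power_dvd_iff by simp
qed

lemma X_power_dvd_pgf:
  assumes "P \<subseteq> {a..}"
  shows "q ^ a dvd pgf P - 1"
  unfolding X_power_dvd_iff
proof (intro allI impI)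
  fix i assume "i < a"
  have "{p \<in> parts_in P. \<Sum>\<^sub># p = i} = (if i = 0 then {{#}} else {})"
  proof -
    have "p = {#}" if "p \<in> parts_in P" "\<Sum>\<^sub># p < a" for p
    proof (rule ccontr)
      assume "p \<noteq> {#}"
      then obtain x p' where "p = add_mset x p'" by (meson multiset_cases)
      then show False using that assms by (auto simp: parts_in_def)
    qed
    moreover have "{#} \<in> parts_in P" by (simp add: parts_in_def)
    ultimately have "p \<in> parts_in P \<and> \<Sum>\<^sub># p = i \<longleftrightarrow> i = 0 \<and> p = {#}" for p
      using \<open>i < a\<close> by (cases "p = {#}") auto
    then show ?thesis by auto
  qed
  then show "(pgf P - 1) $ i = 0" by (simp add: pgf_def gf_nth)
qed

lemma pgf_Un:
  assumes "P \<inter> Q = {}"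
  shows "pgf (P \<union> Q) = pgf P * pgf Q"
proof -
  let ?g = "\<lambda>p. (filter_mset (\<lambda>k. k \<in> P) p, filter_mset (\<lambda>k. k \<notin> P) p)"
  have "bij_betw (\<lambda>(a, b). a + b) (parts_in P \<times> parts_in Q) (parts_in (P \<union> Q))"
  proof (rule bij_betw_byWitness[where f' = ?g])
    show "\<forall>x\<in>parts_in P \<times> parts_in Q. ?g ((\<lambda>(a, b). a + b) x) = x"
    proof
      fix x assume "x \<in> parts_in P \<times> parts_in Q"
      then obtain a b where x: "x = (a, b)" and ab: "a \<in> parts_in P" "b \<in> parts_in Q" by auto
      have "filter_mset (\<lambda>k. k \<in> P) a = a" "filter_mset (\<lambda>k. k \<notin> P) a = {#}"
        "filter_mset (\<lambda>k. k \<in> P) b = {#}" "filter_mset (\<lambda>k. k \<notin> P) b = b"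
        using ab assms by (auto simp: parts_in_def filter_mset_eq_conv)
      then show "?g ((\<lambda>(a, b). a + b) x) = x"
        by (simp add: x)
    qed
  qed (auto simp: parts_in_def)
  then have "pgf (P \<union> Q) = gf (parts_in P \<times> parts_in Q) (\<lambda>(a, b). sum_mset a + sum_mset b)
      (\<lambda>(a, b). 1 * 1)"
    unfolding pgf_def by (rule gf_bij) auto
  then show ?thesis by (simp only: gf_Times fin_fibres_parts_in pgf_def)
qed

definition fsets :: "nat \<Rightarrow> nat set set" where "fsets a = {S. finite S \<and> S \<subseteq> {a..}}"

definition distinct_gf :: "nat \<Rightarrow> int fps" where "distinct_gf a = gf (fsets a) (\<lambda>S. \<Sum>S) (\<lambda>_. 1)"

lemma fin_fibres_fsets: "fin_fibres (fsets a) (\<lambda>S. \<Sum>S)"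
  unfolding fin_fibres_def
proof
  fix n
  have "{S \<in> fsets a. \<Sum>S = n} \<subseteq> Pow {..n}"
    by (auto simp: fsets_def intro: member_le_sum)
  then show "finite {S \<in> fsets a. \<Sum>S = n}" by (rule finite_subset) simp
qed

lemma distinct_gf_step: "distinct_gf a = (1 + q ^ a) * distinct_gf (Suc a)"
proof -
  let ?B = "{S \<in> fsets a. a \<in> S}"
  have ivl: "{Suc a..} = {a..} - {a}" by auto
  have "bij_betw (insert a) (fsets (Suc a)) ?B"
    by (rule bij_betw_byWitness[where f' = "\<lambda>S. S - {a}"]) (auto simp: fsets_def ivl)
  then have "gf ?B (\<lambda>S. \<Sum>S) (\<lambda>_. 1) = gf (fsets (Suc a)) (\<lambda>S. \<Sum>S + a) (\<lambda>_. 1)"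
  proof (rule gf_bij)
    fix S assume S: "S \<in> fsets (Suc a)"
    then have "a \<notin> S" by (auto simp: fsets_def)
    then show "\<Sum>(insert a S) = \<Sum>S + a" using S by (simp add: fsets_def)
  qed simp
  then have B: "gf ?B (\<lambda>S. \<Sum>S) (\<lambda>_. 1) = q ^ a * distinct_gf (Suc a)"
    by (simp only: gf_shift distinct_gf_def)
  have "distinct_gf a = gf (fsets (Suc a) \<union> ?B) (\<lambda>S. \<Sum>S) (\<lambda>_. 1)"
    unfolding distinct_gf_def
    by (rule gf_cong) (auto simp: fsets_def ivl)
  also have "\<dots> = distinct_gf (Suc a) + gf ?B (\<lambda>S. \<Sum>S) (\<lambda>_. 1)"
    unfolding distinct_gf_def
  proof (rule gf_Un)
    show "fin_fibres ?B (\<lambda>S. \<Sum>S)"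
      using fin_fibres_fsets by (rule fin_fibres_subset) auto
  qed (rule fin_fibres_fsets, auto simp: fsets_def)
  finally show ?thesis by (simp add: B algebra_simps)
qed

lemma X_power_dvd_distinct_gf: "q ^ a dvd distinct_gf a - 1"
  unfolding X_power_dvd_iff
proof (intro allI impI)
  fix i assume "i < a"
  have "{S \<in> fsets a. \<Sum>S = i} = (if i = 0 then {{}} else {})"
  proof -
    have "S = {}" if "S \<in> fsets a" "\<Sum>S < a" for S
    proof (rule ccontr)
      assume "S \<noteq> {}"
      then obtain x where x: "x \<in> S" by auto
      then have "x \<le> \<Sum>S" using that by (intro member_le_sum) (auto simp: fsets_def)
      then show False using that x by (auto simp: fsets_def)
    qed
    moreover have "{} \<in> fsets a" by (simp add: fsets_def)
    ultimately have "S \<in> fsets a \<and> \<Sum>S = i \<longleftrightarrow> i = 0 \<and> S = {}" for S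
      using \<open>i < a\<close> by (cases "S = {}") auto
    then show ?thesis by auto
  qed
  then show "(distinct_gf a - 1) $ i = 0" by (simp add: distinct_gf_def gf_nth)
qed

text \<open>Euler's product argument in finite steps: multiplying by \<open>1 - q ^ a\<close> takes
  the defect \<open>d a\<close> to \<open>d (Suc a)\<close>, and \<open>q ^ a\<close> divides
  \<open>d a\<close>. Descending from \<open>J\<close> to 1 gives \<open>q ^ J dvd d 1\<close> for
  every \<open>J\<close>, so \<open>d 1 = 0\<close>.\<close>

lemma euler_distinct_odd: "distinct_gf 1 = odd_gf 1"
proof -
  define E where "E a = pgf {n. even n \<and> n \<ge> 2 * a}" for a
  define d where "d a = distinct_gf a * E a - pgf {a..}" for a
  have d_step: "(1 - q ^ a) * d a = d (Suc a)" if "a > 0" for a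
  proof -
    have "{n. even n \<and> n \<ge> 2 * a} - {2 * a} = {n. even n \<and> n \<ge> 2 * Suc a}"
      by auto
    then have "(1 - q ^ (2 * a)) * E a = E (Suc a)"
      using pgf_remove[of "2 * a" "{n. even n \<and> n \<ge> 2 * a}"] that by (simp add: E_def)
    moreover have "(1 - q ^ a) * (1 + q ^ a) = 1 - q ^ (2 * a)"
      unfolding mult_2 power_add by algebra
    moreover have "(1 - q ^ a) * (distinct_gf a * E a)
        = distinct_gf (Suc a) * ((1 - q ^ a) * (1 + q ^ a) * E a)"
      by (subst distinct_gf_step) (simp only: mult_ac)
    ultimately have "(1 - q ^ a) * (distinct_gf a * E a) = distinct_gf (Suc a) * E (Suc a)"
      by (simp only:)
    moreover have "{a..} - {a} = {Suc a..}" by auto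
    then have "(1 - q ^ a) * pgf {a..} = pgf {Suc a..}"
      using pgf_remove[of a "{a..}"] that by simp
    ultimately show ?thesis by (simp add: d_def right_diff_distrib)
  qed
  have d_self: "q ^ a dvd d a" for a
  proof -
    have "d a = (distinct_gf a - 1) * E a + (E a - 1) - (pgf {a..} - 1)"
      by (simp add: d_def algebra_simps)
    moreover have "q ^ a dvd E a - 1" unfolding E_def by (rule X_power_dvd_pgf) auto
    ultimately show ?thesis
      using X_power_dvd_distinct_gf[of a] X_power_dvd_pgf[of "{a..}" a]
      by (simp only: dvd_add dvd_diff dvd_mult2 order_refl)
  qed
  have "q ^ J dvd d 1" for J
  proof (cases "J = 0")
    case False
    then have "1 \<le> J" by simp
    then show ?thesis
    proof (induction rule: inc_induct)
      case base
      show ?case by (rule d_self)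
    next
      case (step a)
      then have "q ^ J dvd (1 - q ^ a) * d a" using d_step[of a] by simp
      then show ?case by (rule X_power_dvd_cancel[rotated]) (use step in simp)
    qed
  qed simp
  then have "d 1 = 0" by (rule X_power_dvd_all_imp_0)
  \<comment> \<open>Splitting all parts by parity lets the even factor \<open>E 1\<close>
    cancel.\<close>
  moreover have "pgf {1..} = odd_gf 1 * E 1"
  proof -
    have "{1..} = {n. odd n \<and> n \<ge> 1} \<union> {n::nat. even n \<and> n \<ge> 2 * 1}"
      by (rule set_eqI) (simp, presburger)
    moreover have "{n. odd n \<and> n \<ge> 1} \<inter> {n::nat. even n \<and> n \<ge> 2 * 1} = {}" by auto
    ultimately show ?thesis unfolding odd_gf_def E_def by (simp only: pgf_Un)
  qed
  ultimately have "(distinct_gf 1 - odd_gf 1) * E 1 = 0" by (simp add: d_def algebra_simps)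
  moreover have "E 1 \<noteq> 0"
  proof -
    have "q ^ 1 dvd E 1 - 1" unfolding E_def by (rule X_power_dvd_pgf) auto
    then have "(E 1 - 1) $ 0 = 0" unfolding X_power_dvd_iff by simp
    then show ?thesis by auto
  qed
  ultimately show ?thesis by simp
qed

subsection \<open>The generating function of overpartitions by second residual crank\<close>

definition crank_contribution :: "int \<Rightarrow> nat multiset \<Rightarrow> int" where
  "crank_contribution m p =
    (if p = {#1#} then (if m = 0 then - 1 else if m = - 1 \<or> m = 1 then 1 else 0)
     else (if crank p = m then 1 else 0))"

definition crank_gf :: "int \<Rightarrow> int fps" where
  "crank_gf m = gf (parts_in UNIV) sum_mset (crank_contribution m)"

text \<open>An overlined size uses up one copy of its part, odd or even; only the remaining copies
  are split by parity, and the even ones are halved.\<close>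

lemma overpartition_bij:
  "bij_betw (\<lambda>(S, r, e). (mset_set S + r + image_mset ((*) 2) e, S))
    (fsets 1 \<times> (parts_in {n. odd n \<and> n \<ge> 1} \<times> parts_in UNIV))
    {(p, S). 0 \<notin># p \<and> S \<subseteq> set_mset p}" (is "bij_betw ?f ?A ?B")
  and halved_evens_overpartition:
    "\<lbrakk>S \<in> fsets 1; r \<in> parts_in {n. odd n \<and> n \<ge> 1}\<rbrakk> \<Longrightarrow>
      halved_evens (mset_set S + r + image_mset ((*) 2) e, S) = e"
proof -
  have odd_part: "filter_mset odd (r + image_mset ((*) 2) e) = r"
    and even_part: "filter_mset even (r + image_mset ((*) 2) e) = image_mset ((*) 2) e"
    if "r \<in> parts_in {n. odd n \<and> n \<ge> 1}" for r e :: "nat multiset"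
  proof -
    have "filter_mset odd r = r" "filter_mset even r = {#}"
      using that by (auto simp: parts_in_def filter_mset_eq_conv)
    moreover have "filter_mset odd (image_mset ((*) 2) e) = {#}"
      "filter_mset even (image_mset ((*) 2) e) = image_mset ((*) 2) e"
      by (induction e) auto
    ultimately show "filter_mset odd (r + image_mset ((*) 2) e) = r"
      "filter_mset even (r + image_mset ((*) 2) e) = image_mset ((*) 2) e" by simp_all
  qed
  have half: "image_mset (\<lambda>k. k div 2) (image_mset ((*) 2) e) = e" for e :: "nat multiset"
    by (simp add: image_mset.compositionality comp_def)
  have dbl: "image_mset ((*) 2) (image_mset (\<lambda>k. k div 2) (filter_mset even r)) = filter_mset even r"
    for r :: "nat multiset"
    by (induction r) auto
  show halved: "halved_evens (mset_set S + r + image_mset ((*) 2) e, S) = e"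
    if "S \<in> fsets 1" "r \<in> parts_in {n. odd n \<and> n \<ge> 1}" for S r e
  proof -
    have "nonoverlined (mset_set S + r + image_mset ((*) 2) e, S) = r + image_mset ((*) 2) e"
      by (simp add: add.assoc)
    then show ?thesis using even_part[OF that(2)] half by (simp add: halved_evens_def)
  qed
  let ?g = "\<lambda>(p, S). (S, filter_mset odd (p - mset_set S), halved_evens (p, S))"
  show "bij_betw ?f ?A ?B"
  proof (rule bij_betw_byWitness[where f' = ?g])
    show "\<forall>x\<in>?A. ?g (?f x) = x"
      using halved odd_part by (auto simp: add.assoc)
    show "\<forall>x\<in>?B. ?f (?g x) = x"
    proof
      fix x assume "x \<in> ?B"
      then obtain p S where x: "x = (p, S)" and S: "S \<subseteq> set_mset p" by auto
      then have sub: "mset_set S \<subseteq># p"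
        by (auto intro!: mset_subset_eqI simp: count_mset_set' Suc_le_eq)
      have "filter_mset odd r + filter_mset even r = r" for r :: "nat multiset"
        using multiset_partition[of r odd] by simp
      moreover define r where "r = p - mset_set S"
      moreover have "halved_evens (p, S) = image_mset (\<lambda>k. k div 2) (filter_mset even r)"
        by (simp only: halved_evens_def nonoverlined.simps r_def)
      moreover have "mset_set S + r = p" using sub by (simp add: r_def)
      ultimately show "?f (?g x) = x"
        by (simp only: x prod.case dbl add.assoc)
    qed
    show "?f ` ?A \<subseteq> ?B"
      by (fastforce simp: fsets_def parts_in_def subset_iff Suc_le_eq)
    show "?g ` ?B \<subseteq> ?A"
    proof
      fix y assume "y \<in> ?g ` ?B"
      then obtain p S where y: "y = ?g (p, S)" and p: "0 \<notin># p" and S: "S \<subseteq> set_mset p" by auto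
      define r where "r = p - mset_set S"
      have r: "k > 0" if "k \<in># r" for k
        using that p by (metis in_diffD r_def gr0I)
      have "S \<in> fsets 1"
      proof -
        have "finite S" "0 \<notin> S" using S p by (auto intro: finite_subset)
        then show ?thesis by (auto simp: fsets_def Suc_le_eq) (metis gr0I)
      qed
      moreover have "filter_mset odd r \<in> parts_in {n. odd n \<and> n \<ge> 1}"
        using r by (auto simp: parts_in_def Suc_le_eq)
      moreover have "image_mset (\<lambda>k. k div 2) (filter_mset even r) \<in> parts_in UNIV"
        using r[of 0] by (auto simp: parts_in_def elim!: evenE)
      ultimately show "y \<in> ?A"
        by (simp add: y halved_evens_def r_def del: filter_diff_mset)
    qed
  qed
qed

text \<open>The overlined parts give \<open>distinct_gf 1\<close>, which Euler's theorem turns into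
  a second \<open>odd_gf 1\<close>. The halved partition counts with twice its sum, hence
  \<open>sq\<close>.\<close>

lemma M2_bar_gf: "Abs_fps (M2_bar m) = odd_gf 1 ^ 2 * sq (crank_gf m)"
proof -
  let ?B = "{(p, S). 0 \<notin># p \<and> S \<subseteq> set_mset p} :: (nat multiset \<times> nat set) set"
  let ?O = "parts_in {n. odd n \<and> n \<ge> 1}"
  let ?w = "\<lambda>(r, e). sum_mset r + 2 * sum_mset e"
  have fin2: "fin_fibres (parts_in UNIV) (\<lambda>e. 2 * sum_mset e)"
    unfolding fin_fibres_def
  proof
    fix n
    have "{a \<in> parts_in UNIV. 2 * \<Sum>\<^sub># a = n} \<subseteq> {a \<in> parts_in UNIV. \<Sum>\<^sub># a = n div 2}" by auto
    then show "finite {a \<in> parts_in UNIV. 2 * \<Sum>\<^sub># a = n}"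
      using fin_fibres_parts_in[of UNIV] finite_subset unfolding fin_fibres_def by blast
  qed
  have "Abs_fps (M2_bar m) = gf ?B (\<lambda>x. sum_mset (fst x)) (M2_contribution m)"
  proof (rule fps_ext)
    fix n
    have "overpartitions n = {x \<in> ?B. \<Sum>\<^sub># (fst x) = n}"
      by (auto simp: overpartitions_def partitions_def)
    then show "Abs_fps (M2_bar m) $ n = gf ?B (\<lambda>x. sum_mset (fst x)) (M2_contribution m) $ n"
      by (simp add: M2_bar_def gf_nth)
  qed
  also have "\<dots> = gf (fsets 1 \<times> (?O \<times> parts_in UNIV)) (\<lambda>(S, x). \<Sum>S + ?w x)
      (\<lambda>(S, x). 1 * (\<lambda>(r, e). 1 * crank_contribution m e) x)"
  proof (rule gf_bij[OF overpartition_bij])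
    fix x assume x: "x \<in> fsets 1 \<times> (?O \<times> parts_in UNIV)"
    obtain S r e where [simp]: "x = (S, r, e)" by (cases x)
    have "\<Sum>\<^sub># (image_mset ((*) 2) e) = 2 * \<Sum>\<^sub># e"
      by (induction e) auto
    moreover have "\<Sum>\<^sub># (mset_set S) = \<Sum>S"
      by (simp add: sum_unfold_sum_mset)
    ultimately show "\<Sum>\<^sub># (fst ((\<lambda>(S, r, e). (mset_set S + r + image_mset ((*) 2) e, S)) x)) =
      (\<lambda>(S, x). \<Sum>S + ?w x) x"
      by simp
    show "M2_contribution m ((\<lambda>(S, r, e). (mset_set S + r + image_mset ((*) 2) e, S)) x)
       = (\<lambda>(S, x). 1 * (\<lambda>(r, e). 1 * crank_contribution m e) x) x"
      using x by (simp add: M2_contribution_def second_residual_crank_def crank_contribution_def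
          halved_evens_overpartition)
  qed
  also have "\<dots> = distinct_gf 1 * (odd_gf 1 * sq (crank_gf m))"
    by (simp only: gf_Times fin_fibres_Times fin_fibres_fsets fin_fibres_parts_in fin2
          distinct_gf_def odd_gf_def pgf_def crank_gf_def sq_gf)
  finally show ?thesis
    by (simp add: euler_distinct_odd[unfolded One_nat_def] power2_eq_square mult_ac)
qed

subsection \<open>The generating function of the crank\<close>

definition crank_ones :: "nat \<Rightarrow> nat \<Rightarrow> nat multiset set" where
  "crank_ones m j = {p \<in> parts_in UNIV. crank p = int m \<and> count p 1 = j}"

lemma fin_fibres_crank_ones: "fin_fibres (crank_ones m j) sum_mset"
  by (rule fin_fibres_subset[OF fin_fibres_parts_in[of UNIV]]) (auto simp: crank_ones_def)

lemma pgf_from_2: "j > 0 \<Longrightarrow> pgf {2..j} = (1 - q) * inv_qfac j"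
proof -
  assume "j > 0"
  moreover have "{1..j} - {1} = {2..j}" by auto
  ultimately show ?thesis using pgf_remove[of 1 "{1..j}"] by (simp add: inv_qfac_def)
qed

text \<open>With \<open>j\<close> ones, crank \<open>m\<close> forces exactly \<open>m + j\<close>
  parts above \<open>j\<close>, while the parts from 2 to \<open>j\<close> are free and give
  \<open>(1 - q) * inv_qfac j\<close>.\<close>

lemma gf_crank_ones_pos:
  assumes "j > 0"
  shows "gf (crank_ones m j) sum_mset (\<lambda>_. 1) =
    (1 - q) * (q ^ (j + (j + 1) * (m + j)) * inv_qfac j * inv_qfac (m + j))"
proof -
  let ?f = "\<lambda>(a, b). replicate_mset j 1 + a + b :: nat multiset"
  let ?g = "\<lambda>p. (filter_mset (\<lambda>k. 2 \<le> k \<and> k \<le> j) p, filter_mset (\<lambda>k. k > j) p)"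
  let ?A = "parts_in {2..j} \<times> sized (m + j) (Suc j)"
  have fil: "filter_mset (\<lambda>k. 2 \<le> k \<and> k \<le> j) (replicate_mset j 1 + a + b) = a"
    "filter_mset (\<lambda>k. k > j) (replicate_mset j 1 + a + b) = b"
    "count (replicate_mset j 1 + a + b) 1 = j"
    if "a \<in> parts_in {2..j}" "b \<in> sized (m + j) (Suc j)" for a b
  proof -
    have a: "count a k = 0" if "k < 2 \<or> k > j" for k
      using \<open>a \<in> _\<close> that by (force simp: parts_in_def count_eq_zero_iff)
    have b: "count b k = 0" if "k \<le> j" for k
      using \<open>b \<in> _\<close> that by (force simp: sized_def count_eq_zero_iff)
    show "filter_mset (\<lambda>k. 2 \<le> k \<and> k \<le> j) (replicate_mset j 1 + a + b) = a"
      "filter_mset (\<lambda>k. k > j) (replicate_mset j 1 + a + b) = b"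
      "count (replicate_mset j 1 + a + b) 1 = j"
      using a b assms by (auto intro!: multiset_eqI simp: not_le not_less)
  qed
  have "bij_betw ?f ?A (crank_ones m j)"
  proof (rule bij_betw_byWitness[where f' = ?g])
    show "\<forall>x\<in>?A. ?g (?f x) = x" using fil by auto
    show "\<forall>p\<in>crank_ones m j. ?f (?g p) = p"
    proof
      fix p assume p: "p \<in> crank_ones m j"
      then have "count p 0 = 0" "count p 1 = j"
        by (auto simp: crank_ones_def parts_in_def count_eq_zero_iff)
      then have "count (?f (?g p)) k = count p k" for k
        using assms by (cases "k = 0"; cases "k = 1") auto
      then show "?f (?g p) = p" by (rule multiset_eqI)
    qed
    show "?f ` ?A \<subseteq> crank_ones m j"
    proof clarify
      fix a b assume ab: "a \<in> parts_in {2..j}" "b \<in> sized (m + j) (Suc j)"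
      let ?p = "replicate_mset j 1 + a + b"
      have "1 \<in># ?p" using assms by simp
      then have "crank ?p = int m"
        unfolding crank_def fil(3)[OF ab] fil(2)[OF ab] using ab by (simp add: sized_def)
      then show "?p \<in> crank_ones m j"
        using ab fil(3)[OF ab] by (auto simp: crank_ones_def parts_in_def sized_def)
    qed
    show "?g ` crank_ones m j \<subseteq> ?A"
    proof clarify
      fix p assume p: "p \<in> crank_ones m j"
      then have c: "count p 1 = j" "crank p = int m" by (auto simp: crank_ones_def)
      then have "1 \<in># p" using assms by (metis count_greater_zero_iff)
      then have "size (filter_mset (\<lambda>k. k > j) p) = m + j"
        using c by (simp add: crank_def)
      then show "filter_mset (\<lambda>k. 2 \<le> k \<and> k \<le> j) p \<in> parts_in {2..j} \<and>
        filter_mset (\<lambda>k. k > j) p \<in> sized (m + j) (Suc j)"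
        by (auto simp: parts_in_def sized_def)
    qed
  qed
  then have "gf (crank_ones m j) sum_mset (\<lambda>_. 1) =
    gf ?A (\<lambda>x. (\<lambda>(a, b). sum_mset a + sum_mset b) x + j) (\<lambda>(a, b). 1 * 1)"
    by (rule gf_bij) auto
  also have "\<dots> = q ^ j * (pgf {2..j} * (q ^ (Suc j * (m + j)) * inv_qfac (m + j)))"
    by (simp only: gf_shift gf_Times fin_fibres_parts_in fin_fibres_sized[OF zero_less_Suc]
        gf_sized[OF zero_less_Suc] pgf_def)
  finally show ?thesis using assms by (simp add: pgf_from_2 power_add mult_ac)
qed

text \<open>Without ones the crank of a nonempty partition is its largest part; for
  \<open>m \<ge> 2\<close>, removing one copy of it leaves parts in \<open>{2..m}\<close>. At
  \<open>m = 0\<close> only the empty partition occurs and at \<open>m = 1\<close> none, so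
  \<open>- q\<close> and \<open>q\<close> make up the difference.\<close>

lemma gf_crank_ones_0:
  "gf (crank_ones m 0) sum_mset (\<lambda>_. 1) + of_int (if m = 0 then - 1 else if m = 1 then 1 else 0) * q
    = (1 - q) * (q ^ m * inv_qfac m)"
proof -
  have mem: "p \<in> crank_ones m 0 \<longleftrightarrow> p \<in> parts_in {2..} \<and>
     (if p = {#} then m = 0 else m = Max (set_mset p))" for p
  proof -
    have "p \<in> parts_in UNIV \<and> count p 1 = 0 \<longleftrightarrow> p \<in> parts_in {2..}"
      unfolding parts_in_def count_eq_zero_iff subset_iff
      by auto (metis Suc_leI le_neq_implies_less numeral_2_eq_2)
    then show ?thesis by (auto simp: crank_ones_def crank_def count_eq_zero_iff)
  qed
  have ge2: "Max (set_mset p) \<ge> 2" if "p \<in> parts_in {2..}" "p \<noteq> {#}" for p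
  proof -
    have "Max (set_mset p) \<in> set_mset p" using that by (intro Max_in) auto
    then have "Max (set_mset p) \<in> {2..}" using that(1) unfolding parts_in_def by blast
    then show ?thesis by simp
  qed
  consider "m = 0" | "m = 1" | "m \<ge> 2" by linarith
  then show ?thesis
  proof cases
    case 1
    have "{#} \<in> parts_in {2..}" by (simp add: parts_in_def)
    then have "p \<in> crank_ones m 0 \<longleftrightarrow> p = {#}" for p
      using 1 mem[of p] ge2[of p] by (cases "p = {#}") auto
    then have "crank_ones m 0 = {{#}}" by blast
    then show ?thesis using 1 by (simp add: gf_singleton inv_qfac_0)
  next
    case 2
    have "p \<notin> crank_ones m 0" for p
      using 2 mem[of p] ge2[of p] by (cases "p = {#}") auto
    then have "crank_ones m 0 = {}" by blast
    then show ?thesis using 2 inv_qfac_Suc[of 0]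
      by (simp add: gf_empty inv_qfac_0 mult.left_commute)
  next
    case 3
    have "bij_betw (add_mset m) (parts_in {2..m}) (crank_ones m 0)"
    proof (rule bij_betw_byWitness[where f' = "\<lambda>p. p - {#m#}"])
      show "add_mset m ` parts_in {2..m} \<subseteq> crank_ones m 0"
      proof clarify
        fix p assume p: "p \<in> parts_in {2..m}"
        then have "Max (set_mset (add_mset m p)) = m"
          by (intro Max_eqI) (auto simp: parts_in_def)
        then show "add_mset m p \<in> crank_ones m 0"
          unfolding mem using p 3 by (auto simp: parts_in_def)
      qed
      have *: "m \<in># p \<and> set_mset p \<subseteq> {2..m}" if "p \<in> crank_ones m 0" for p
      proof -
        have p: "p \<noteq> {#}" "m = Max (set_mset p)" "p \<in> parts_in {2..}"
          using that 3 unfolding mem by (auto split: if_splits)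
        then have "m \<in># p" using Max_in[of "set_mset p"] by auto
        moreover have "\<forall>k\<in>#p. k \<le> m" using p by simp
        ultimately show ?thesis using p(3) by (auto simp: parts_in_def)
      qed
      then show "\<forall>p\<in>crank_ones m 0. add_mset m (p - {#m#}) = p" by simp
      show "(\<lambda>p. p - {#m#}) ` crank_ones m 0 \<subseteq> parts_in {2..m}"
        using * by (fastforce simp: parts_in_def dest: in_diffD)
    qed simp
    then have "gf (crank_ones m 0) sum_mset (\<lambda>_. 1)
      = gf (parts_in {2..m}) (\<lambda>p. sum_mset p + m) (\<lambda>_. 1)"
      by (rule gf_bij) auto
    also have "\<dots> = q ^ m * pgf {2..m}" by (simp add: gf_shift pgf_def)
    finally show ?thesis using 3 by (simp add: pgf_from_2 mult_ac)
  qed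
qed

text \<open>A partition with \<open>j\<close> ones has size at least \<open>j\<close>, so the first \<open>J\<close> terms determine all
  coefficients below \<open>J\<close>. The correction \<open>\<epsilon>\<close> at the partition \<open>{#1#}\<close> is exactly what makes the
  term \<open>j = 0\<close> fit the general formula for \<open>m \<le> 1\<close>.\<close>

lemma crank_gf_approx: "q ^ J dvd (crank_gf (int m) - crank_sum m J)"
proof -
  define \<epsilon> :: int where "\<epsilon> = (if m = 0 then - 1 else if m = 1 then 1 else 0)"
  have sum_eq: "crank_sum m J = (\<Sum>j<J. gf (crank_ones m j) sum_mset (\<lambda>_. 1))
      + (if J = 0 then 0 else of_int \<epsilon> * q)"
  proof -
    have "(1 - q) * (q ^ (j + (j + 1) * (m + j)) * inv_qfac j * inv_qfac (m + j))
      = gf (crank_ones m j) sum_mset (\<lambda>_. 1) + (if j = 0 then of_int \<epsilon> * q else 0)" for j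
      using gf_crank_ones_pos[of j m] gf_crank_ones_0[of m]
      by (cases "j = 0") (auto simp: \<epsilon>_def inv_qfac_0)
    then have "crank_sum m J = (\<Sum>j<J. gf (crank_ones m j) sum_mset (\<lambda>_. 1)
      + (if j = 0 then of_int \<epsilon> * q else 0))"
      unfolding crank_sum_def sum_distrib_left by (intro sum.cong) simp_all
    then show ?thesis by (simp add: sum.distrib)
  qed
  have "crank_gf (int m) $ i = crank_sum m J $ i" if "i < J" for i
  proof -
    let ?P = "{p \<in> parts_in UNIV. \<Sum>\<^sub># p = i}"
    have fin: "finite ?P" using fin_fibres_parts_in[of UNIV] by (simp add: fin_fibres_def)
    have "crank {#1#} = - 1" by (simp add: crank_def)
    then have "crank_contribution (int m) p =
        (if crank p = int m then 1 else 0) + (if p = {#1#} then \<epsilon> else 0)" for p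
      by (auto simp: crank_contribution_def \<epsilon>_def)
    then have "crank_gf (int m) $ i = (\<Sum>p\<in>?P. if crank p = int m then 1 else 0)
        + (\<Sum>p\<in>?P. if p = {#1#} then \<epsilon> else 0)"
      by (simp add: crank_gf_def gf_nth sum.distrib)
    also have "(\<Sum>p\<in>?P. if p = {#1#} then \<epsilon> else 0) = (of_int \<epsilon> * q) $ i"
      using fin by (auto simp: sum.delta parts_in_def fps_of_int[symmetric])
    also have "(\<Sum>p\<in>?P. if crank p = int m then 1 else (0::int)) =
      (\<Sum>p\<in>{p \<in> ?P. crank p = int m}. 1)"
      by (rule sum.inter_filter[symmetric, OF fin])
    \<comment> \<open>A partition of \<open>i < J\<close> has fewer than \<open>J\<close> ones, so
      \<open>j < J\<close> exhausts all cases.\<close>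
    also have "{p \<in> ?P. crank p = int m} = (\<Union>j<J. {p \<in> crank_ones m j. \<Sum>\<^sub># p = i})"
    proof -
      have "count p 1 < J" if "p \<in> ?P" for p
      proof -
        have "0 \<notin># p" "\<Sum>\<^sub># p = i" using that by (auto simp: parts_in_def)
        then show ?thesis
          using \<open>i < J\<close> size_le_sum_mset[of p] count_le_size[of p 1] by linarith
      qed
      then show ?thesis by (auto simp: crank_ones_def)
    qed
    also have "(\<Sum>p\<in>(\<Union>j<J. {p \<in> crank_ones m j. \<Sum>\<^sub># p = i}). 1) =
      (\<Sum>j<J. \<Sum>p\<in>{p \<in> crank_ones m j. \<Sum>\<^sub># p = i}. (1::int))"
      using fin_fibres_crank_ones[of m]
      by (intro sum.UNION_disjoint) (auto simp: fin_fibres_def crank_ones_def)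
    also have "\<dots> + (of_int \<epsilon> * q) $ i = crank_sum m J $ i"
      using that by (simp add: sum_eq gf_nth fps_sum_nth)
    finally show ?thesis .
  qed
  then show ?thesis by (simp add: X_power_dvd_iff)
qed

theorem theorem1p5:
  fixes m :: int and n :: nat
  assumes "m \<ge> 1"
  shows "M2_bar (m - 1) n \<ge> M2_bar m n"
proof -
  define k where "k = nat (m - 1)"
  then have "m = int (Suc k)" using assms by simp
  then have "nonneg (odd_gf 1 ^ 2 * sq (crank_gf (m - 1) - crank_gf m))"
    using nonneg_crank_diff[OF crank_gf_approx[of _ k] crank_gf_approx[of _ "Suc k"]] by simp
  \<comment> \<open>The common factor and the additivity of \<open>sq\<close> make this one series
    whose coefficients are the differences for all \<open>n\<close> at once.\<close>
  also have "odd_gf 1 ^ 2 * sq (crank_gf (m - 1) - crank_gf m)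
    = Abs_fps (M2_bar (m - 1)) - Abs_fps (M2_bar m)"
    by (simp only: M2_bar_gf sq_simps right_diff_distrib)
  finally show ?thesis by (simp add: nonneg_def)
qed

end
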